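(* For every $t\in(0,\infty)$, the Rips magnitudes of the Euclidean cycles $C_n^{\mathrm{eucl}}$ satisfy $$\sup_{n\in\mathbb{N}}|tC^{\mathrm{eucl}}_n|_{\mathrm{Rips}}=e^{-2t}+2\pi t\sum_{r\text{ odd}}\frac1r\,e^{-2t\cos\left(\frac\pi{2r}\right)}\sin\left(\frac\pi{2r}\right),$$ where the supremum is over positive integers $n$ and the sum is over all positive odd integers $r$.
   Context: $C_n^{\mathrm{eucl}}$ denotes the set of $n$ equidistant points on the unit circle in $\mathbb{R}^2$ with the Euclidean metric. For a finite metric space $X$, the Rips magnitude function $|tX|_{\mathrm{Rips}}$ is the persistent magnitude function of the persistent homology of its Vietoris–Rips complex; equivalently, it is given for $t\in(0,\infty)$ by $|tX|_{\mathrm{Rips}}=\sum_{\emptyset\ne A\subseteq X}(-1)^{\#A-1}e^{-\mathrm{diam}(A)t}$. *)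

theory Defs
  imports "HOL-Analysis.Analysis"
begin

text \<open>
  The Rips magnitude function \<open>t \<mapsto> |tX|\<close> of a finite metric space, i.e. the persistent magnitude
  of the persistent homology of its Vietoris--Rips complex, in the equivalent form of an
  alternating sum over simplices.  The space is presented as a finite subset
  \<open>X\<close> of a metric space with the induced metric.  A simplex \<open>A\<close> of the Vietoris--Rips
  filtration enters at scale \<open>diameter A\<close>, and contributes there with the sign of its dimension
  \<open>card A - 1\<close>.  The subtraction on \<^typ>\<open>nat\<close> is harmless since \<open>A\<close> is finite and nonempty.
\<close>

definition rips_magnitude :: "'a::metric_space set \<Rightarrow> real \<Rightarrow> real" where
  "rips_magnitude X t =
     (\<Sum>A | A \<noteq> {} \<and> A \<subseteq> X. (-1) ^ (card A - 1) * exp (- (diameter A * t)))"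

definition eucl_cycle :: "nat \<Rightarrow> (real ^ 2) set" where
  "eucl_cycle n =
     (\<lambda>k. vector [cos (2 * pi * real k / real n), sin (2 * pi * real k / real n)]) ` {..<n}"

end

theory Submission
  imports Defs
begin

text \<open>
  The diameters occurring in the \<open>n\<close>-th cycle are \<open>2 sin (\<pi> k / n)\<close> with \<open>k \<le> n div 2\<close>, so
  summation by parts expresses its Rips magnitude through the Euler characteristics of the clique
  complexes of the circulant graphs in which points at cyclic distance at most \<open>k\<close> are adjacent.
  For \<open>2 k < n\<close> this Euler characteristic is \<open>n - 2 k\<close> if \<open>n - 2 k\<close> divides \<open>k\<close>, and \<open>0\<close>
  otherwise.  To see it, lift a clique to an \<open>n\<close>-periodic set of integers and group the cliques by the
  set of those elements that come first after a gap.  Each group is an interval of the lattice of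
  periodic sets, so its signed count cancels unless it is a singleton, and the singletons are the
  cosets of the multiples of \<open>n - 2 k\<close>.

  The nonzero terms are indexed by the odd divisors \<open>q = n / (n - 2 k)\<close> of \<open>n\<close>, and the term of
  \<open>q\<close> is a secant slope of the convex function \<open>x \<mapsto> exp (- 2 t sin x)\<close> at \<open>\<pi> / 2 - \<pi> / (2 q)\<close>.
  It is bounded by the tangent slope there, the \<open>q\<close>-th term of the series, which gives the
  upper bound.  The bound is approached along even \<open>n\<close> divisible by any given finite set of odd
  numbers.
\<close>

section \<open>Extremal elements of bounded integer sets\<close>

lemma int_set_ex_least:
  fixes S :: "int set"
  assumes "x \<in> S" and "\<forall>u\<in>S. c \<le> u"
  shows "\<exists>a\<in>S. \<forall>u\<in>S. a \<le> u"
proof -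
  from ex_has_least_nat[of "\<lambda>u. u \<in> S" x "\<lambda>u. nat (u - c)"] assms(1)
  obtain a where a: "a \<in> S" "\<forall>u. u \<in> S \<longrightarrow> nat (a - c) \<le> nat (u - c)" by blast
  have "a \<le> u" if "u \<in> S" for u
    using a(2)[rule_format, OF that] bspec[OF assms(2) that] bspec[OF assms(2) a(1)] by linarith
  then show ?thesis using a(1) by blast
qed

lemma int_set_ex_greatest:
  fixes S :: "int set"
  assumes "x \<in> S" and "\<forall>u\<in>S. u \<le> c"
  shows "\<exists>a\<in>S. \<forall>u\<in>S. u \<le> a"
  using int_set_ex_least[of "- x" "uminus ` S" "- c"] assms by auto

section \<open>Cliques of circulant graphs as periodic sets of integers\<close>

text \<open>On indices in \<open>{0..<n}\<close> this bounds all cyclic distances by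
  \<open>k\<close>: the cyclic distance is the smaller of the absolute difference and its complement
  to \<open>n\<close>.\<close>

definition circ_clique :: "int \<Rightarrow> int \<Rightarrow> int set \<Rightarrow> bool" where
  "circ_clique n k I \<longleftrightarrow> (\<forall>a\<in>I. \<forall>w\<in>I. \<bar>a - w\<bar> \<le> k \<or> n - k \<le> \<bar>a - w\<bar>)"

locale circulant =
  fixes n k :: int
  assumes k_nonneg: "0 \<le> k" and k_less: "2 * k < n"
begin

definition periodic :: "int set \<Rightarrow> bool" where
  "periodic P \<longleftrightarrow> (\<forall>x. x + n \<in> P \<longleftrightarrow> x \<in> P)"

text \<open>
  For periodic \<open>P\<close> this says that \<open>P\<close> modulo \<open>n\<close> is a clique of the circulant graph: differences
  that are negative or at least \<open>n\<close> satisfy the condition trivially.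
\<close>

definition clique :: "int set \<Rightarrow> bool" where
  "clique P \<longleftrightarrow> (\<forall>a\<in>P. \<forall>w\<in>P. a - w \<le> k \<or> n - k \<le> a - w)"

text \<open>A clique containing \<open>w\<close> has no element strictly between
  \<open>w + k\<close> and \<open>w + n - k\<close>, so \<open>a\<close> is its first element after
  the gap forced by \<open>w\<close>.\<close>

definition succ_of :: "int set \<Rightarrow> int \<Rightarrow> int \<Rightarrow> bool" where
  "succ_of P w a \<longleftrightarrow> a \<in> P \<and> w + n - k \<le> a \<and> (\<forall>u\<in>P. w + n - k \<le> u \<longrightarrow> a \<le> u)"

definition starts :: "int set \<Rightarrow> int set" where
  "starts P = {a. \<exists>w\<in>P. succ_of P w a}"

text \<open>The largest clique with set of starts \<open>T\<close>.\<close>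

definition envelope :: "int set \<Rightarrow> int set" where
  "envelope T = {x. \<exists>r\<in>T. r \<le> x \<and> (\<forall>q\<in>T. q + n - k \<le> r \<or> x - k \<le> q)}"

lemma n_pos: "0 < n" using k_nonneg k_less by linarith

lemma periodic_minus: "periodic P \<Longrightarrow> x - n \<in> P \<longleftrightarrow> x \<in> P"
  unfolding periodic_def by (metis diff_add_cancel)

lemma periodic_plus: "periodic P \<Longrightarrow> x + n \<in> P \<longleftrightarrow> x \<in> P"
  unfolding periodic_def by blast

lemma periodic_mult_nat: "periodic P \<Longrightarrow> x + int j * n \<in> P \<longleftrightarrow> x \<in> P"
proof (induction j)
  case (Suc j)
  have "x + int (Suc j) * n = (x + int j * n) + n" by (simp add: algebra_simps)
  then show ?case using Suc periodic_plus by metis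
qed simp

lemma periodic_mult:
  assumes "periodic P" shows "x + j * n \<in> P \<longleftrightarrow> x \<in> P"
proof (cases "0 \<le> j")
  case True
  then show ?thesis using periodic_mult_nat[OF assms, of x "nat j"] by simp
next
  case False
  then show ?thesis using periodic_mult_nat[OF assms, of "x + j * n" "nat (- j)"] by simp
qed

lemma periodic_mod:
  assumes "periodic P" shows "x mod n \<in> P \<longleftrightarrow> x \<in> P"
  using periodic_mult[OF assms, of "x mod n" "x div n"] by simp

lemma cliqueD: "clique P \<Longrightarrow> a \<in> P \<Longrightarrow> w \<in> P \<Longrightarrow> a - w \<le> k \<or> n - k \<le> a - w"
  unfolding clique_def by blast

section \<open>Successors across a gap, and the starts of a clique\<close>

lemma succ_ex:
  assumes "periodic P" "w \<in> P"
  obtains a where "succ_of P w a" "a \<le> w + n"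
proof -
  have 1: "w + n \<in> {u \<in> P. w + n - k \<le> u}" using assms periodic_plus k_nonneg by auto
  obtain a where a: "a \<in> {u \<in> P. w + n - k \<le> u}" "\<And>u. u \<in> {u \<in> P. w + n - k \<le> u} \<Longrightarrow> a \<le> u"
    using int_set_ex_least[OF 1, of "w + n - k"] by blast
  have "succ_of P w a" unfolding succ_of_def using a by auto
  moreover have "a \<le> w + n" using a(2)[OF 1] .
  ultimately show thesis using that by blast
qed

lemma succ_ofD:
  assumes "succ_of P w a"
  shows "a \<in> P" "w + n - k \<le> a" "\<And>u. u \<in> P \<Longrightarrow> w + n - k \<le> u \<Longrightarrow> a \<le> u"
  using assms unfolding succ_of_def by auto

lemma succ_unique: "succ_of P w a \<Longrightarrow> succ_of P w b \<Longrightarrow> a = b"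
  unfolding succ_of_def by (meson order_antisym)

lemma succ_mono: "succ_of P w a \<Longrightarrow> succ_of P v b \<Longrightarrow> w \<le> v \<Longrightarrow> a \<le> b"
  unfolding succ_of_def by (smt (verit))

lemma succ_shift:
  assumes "periodic P" "succ_of P w a" shows "succ_of P (w + j * n) (a + j * n)"
proof -
  have "a + j * n \<le> u" if "u \<in> P" "w + j * n + n - k \<le> u" for u
  proof -
    have "u + (- j) * n \<in> P" using periodic_mult[OF assms(1)] that(1) by blast
    then have "a \<le> u + (- j) * n" using succ_ofD(3)[OF assms(2)] that(2) by auto
    then show ?thesis by simp
  qed
  then show ?thesis using assms periodic_mult[OF assms(1)] unfolding succ_of_def by auto
qed

lemma starts_subset: "starts P \<subseteq> P"
  unfolding starts_def succ_of_def by blast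

lemma startsI: "w \<in> P \<Longrightarrow> succ_of P w a \<Longrightarrow> a \<in> starts P"
  unfolding starts_def by blast

lemma periodic_starts:
  assumes "periodic P" shows "periodic (starts P)"
proof -
  have *: "x + j * n \<in> starts P" if x: "x \<in> starts P" for x j
  proof -
    obtain w where w: "w \<in> P" "succ_of P w x" using x unfolding starts_def by blast
    then show ?thesis
      using startsI[of "w + j * n"] succ_shift[OF assms w(2)] periodic_mult[OF assms] by blast
  qed
  show ?thesis unfolding periodic_def
  proof (intro allI iffI)
    fix x
    show "x \<in> starts P" if "x + n \<in> starts P" using *[OF that, of "-1"] by simp
    show "x + n \<in> starts P" if "x \<in> starts P" using *[OF that, of 1] by simp
  qed
qed

lemma starts_nonempty:
  assumes "periodic P" "P \<noteq> {}" shows "starts P \<noteq> {}"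
  using assms startsI succ_ex by (metis empty_iff ex_in_conv)

lemma clique_starts: "clique P \<Longrightarrow> clique (starts P)"
  using starts_subset unfolding clique_def by blast

lemma succ_of_starts:
  assumes "w \<in> P" "succ_of P w a" shows "succ_of (starts P) w a"
  using assms startsI[OF assms] starts_subset unfolding succ_of_def by blast

text \<open>The least \<open>m\<close> whose successor is a given start \<open>a\<close> turns out
  to be a start itself, and \<open>a\<close> remains its successor inside
  \<open>starts P\<close>.\<close>

lemma starts_starts:
  assumes "periodic P" "clique P" shows "starts (starts P) = starts P"
proof
  show "starts (starts P) \<subseteq> starts P" by (rule starts_subset)
  show "starts P \<subseteq> starts (starts P)"
  proof
    fix a assume "a \<in> starts P"
    then obtain w where w: "w \<in> P" "succ_of P w a" unfolding starts_def by blast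
    \<comment> \<open>A successor exceeds its argument by at most \<open>n\<close>, so
      \<open>F\<close> is bounded below by \<open>a - n\<close> and has a least element.\<close>
    define F where "F = {u \<in> P. succ_of P u a}"
    have "w \<in> F" using w F_def by simp
    moreover have F_lb: "a - n \<le> u" if "u \<in> F" for u
    proof -
      have "u \<in> P" "succ_of P u a" using that F_def by auto
      with succ_ex[OF assms(1), of u] obtain b where "succ_of P u b" "b \<le> u + n" by blast
      then show ?thesis using succ_unique \<open>succ_of P u a\<close> by fastforce
    qed
    ultimately obtain m where m: "m \<in> F" "\<And>u. u \<in> F \<Longrightarrow> m \<le> u"
      using int_set_ex_least[of w F "a - n"] by blast
    have mP: "m \<in> P" "succ_of P m a" using m F_def by auto
    have "m - n \<in> {u \<in> P. u < m}" using mP periodic_minus[OF assms(1)] n_pos by auto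
    then obtain v where v: "v \<in> {u \<in> P. u < m}" "\<And>u. u \<in> {u \<in> P. u < m} \<Longrightarrow> u \<le> v"
      using int_set_ex_greatest[of "m - n" "{u \<in> P. u < m}" m] by (metis (no_types, lifting) less_imp_le mem_Collect_eq)
    obtain b where b: "succ_of P v b" using succ_ex[OF assms(1)] v by blast
    have "b \<noteq> a" using m(2)[of v] v b F_def by auto
    moreover have "b \<le> a" using succ_mono[OF b mP(2)] v by auto
    ultimately have ba: "b < a" by simp
    have bP: "b \<in> P" "v + n - k \<le> b" using succ_ofD[OF b] by auto
    have "b < m + n - k" using succ_ofD(3)[OF mP(2) bP(1)] ba by linarith
    then have bm: "b - m \<le> k" using cliqueD[OF assms(2) bP(1) mP(1)] by linarith
    have bn: "b - n \<in> P" using bP periodic_minus[OF assms(1)] by blast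
    \<comment> \<open>Any \<open>u\<close> in \<open>P\<close> with \<open>u >= b - k\<close>
      satisfies \<open>u >= v + n - 2 * k > v\<close>, and \<open>v\<close> is the element of
      \<open>P\<close> just before \<open>m\<close>; hence \<open>u >= m\<close>.\<close>
    have "succ_of P (b - n) m"
      unfolding succ_of_def
    proof (intro conjI ballI impI)
      show "m \<in> P" by (rule mP)
      show "b - n + n - k \<le> m" using bm by simp
      fix u assume "u \<in> P" "b - n + n - k \<le> u"
      then show "m \<le> u" using v(2)[of u] bP(2) k_less by force
    qed
    then have "m \<in> starts P" using startsI bn by blast
    then show "a \<in> starts (starts P)" using startsI succ_of_starts[OF mP] by blast
  qed
qed

section \<open>Envelopes, and the sets sharing given starts\<close>

text \<open>The witness for \<open>x\<close> is the last start \<open>r\<close> not after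
  \<open>x\<close>. A start \<open>q < x - k\<close> satisfies \<open>q + n - k <= x\<close> by the
  clique condition, so its successor is a start at most \<open>x\<close>, hence at most
  \<open>r\<close>.\<close>

lemma subset_envelope_starts:
  assumes "periodic P" "clique P" shows "P \<subseteq> envelope (starts P)"
proof
  fix x assume x: "x \<in> P"
  let ?T = "starts P"
  have perT: "periodic ?T" by (rule periodic_starts[OF assms(1)])
  obtain a where a: "succ_of P x a" "a \<le> x + n" using succ_ex[OF assms(1) x] by blast
  have "a - n \<in> {u \<in> ?T. u \<le> x}"
    using a startsI[OF x] periodic_minus[OF perT] by auto
  then obtain r where r: "r \<in> {u \<in> ?T. u \<le> x}" "\<And>u. u \<in> {u \<in> ?T. u \<le> x} \<Longrightarrow> u \<le> r"
    using int_set_ex_greatest[of "a - n" "{u \<in> ?T. u \<le> x}" x] by blast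
  have "q + n - k \<le> r \<or> x - k \<le> q" if q: "q \<in> ?T" for q
  proof (cases "x - k \<le> q")
    case False
    have qP: "q \<in> P" using q starts_subset by blast
    obtain b where b: "succ_of P q b" using succ_ex[OF assms(1) qP] by blast
    have "q + n - k \<le> x" using cliqueD[OF assms(2) x qP] False by linarith
    then have "b \<le> x" using succ_ofD(3)[OF b x] by linarith
    then have "b \<le> r" using r(2) startsI[OF qP b] by blast
    then show ?thesis using succ_ofD(2)[OF b] by linarith
  qed simp
  then show "x \<in> envelope ?T" using r(1) unfolding envelope_def by blast
qed

lemma clique_envelope:
  assumes "periodic T" shows "clique (envelope T)"
  unfolding clique_def
proof (intro ballI)
  fix x y assume "x \<in> envelope T" "y \<in> envelope T"
  then obtain r s where r: "r \<in> T" "r \<le> x" "\<And>q. q \<in> T \<Longrightarrow> q + n - k \<le> r \<or> x - k \<le> q"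
    and s: "s \<in> T" "s \<le> y" "\<And>q. q \<in> T \<Longrightarrow> q + n - k \<le> s \<or> y - k \<le> q"
    unfolding envelope_def by blast
  \<comment> \<open>The condition of \<open>r\<close> at \<open>s\<close> gives
    \<open>x - y <= k\<close> or \<open>s + n - k <= r\<close>. In the second case
    \<open>2 * k < n\<close> excludes \<open>r - k <= s\<close>, so the condition of
    \<open>s\<close> at \<open>r - n\<close> gives \<open>n - k <= x - y\<close>.\<close>
  have "r - n \<in> T" using r periodic_minus[OF assms] by blast
  then show "x - y \<le> k \<or> n - k \<le> x - y"
    using r(2) s(2) r(3)[OF s(1)] s(3)[of "r - n"] k_less by linarith
qed

text \<open>A start \<open>u\<close> of \<open>P\<close> coincides with its envelope witness
  \<open>s\<close> in \<open>T\<close>, so no new starts appear. Conversely, the successor in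
  \<open>P\<close> of an element of \<open>T\<close> is then in \<open>T\<close>, so it cannot
  precede the successor in \<open>T\<close>.\<close>

lemma starts_between:
  assumes "periodic T" "starts T = T" "T \<subseteq> P" "P \<subseteq> envelope T"
  shows "starts P = T"
proof -
  have sub: "starts P \<subseteq> T"
  proof
    fix u assume "u \<in> starts P"
    then obtain x where x: "x \<in> P" "succ_of P x u" unfolding starts_def by blast
    have "x \<in> envelope T" "u \<in> envelope T" using x succ_ofD(1)[OF x(2)] assms(4) by auto
    then obtain r s where r: "r \<in> T" "r \<le> x" "\<And>q. q \<in> T \<Longrightarrow> q + n - k \<le> r \<or> x - k \<le> q"
      and s: "s \<in> T" "s \<le> u" "\<And>q. q \<in> T \<Longrightarrow> q + n - k \<le> s \<or> u - k \<le> q"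
      unfolding envelope_def by blast
    have "s - n \<in> T" using s periodic_minus[OF assms(1)] by blast
    \<comment> \<open>Since \<open>u\<close> lies more than \<open>k\<close> beyond
      \<open>x\<close>, the condition of \<open>s\<close> at \<open>r\<close> yields
      \<open>r + n - k <= s\<close>; the condition of \<open>r\<close> at \<open>s - n\<close> then
      leaves only this inequality.\<close>
    then have "x + n - k \<le> s"
      using r(2) s(2) s(3)[OF r(1)] r(3)[of "s - n"] succ_ofD(2)[OF x(2)] k_less by linarith
    then have "u \<le> s" using succ_ofD(3)[OF x(2)] s(1) assms(3) by blast
    then show "u \<in> T" using s by auto
  qed
  moreover have "T \<subseteq> starts P"
  proof
    fix a assume "a \<in> T"
    then obtain w where w: "w \<in> T" "succ_of T w a" using assms(2) unfolding starts_def by blast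
    have "succ_of P w a"
      unfolding succ_of_def
    proof (intro conjI ballI impI)
      show aP: "a \<in> P" using \<open>a \<in> T\<close> assms(3) by blast
      show "w + n - k \<le> a" using succ_ofD[OF w(2)] by blast
      have wP: "w \<in> P" using w assms(3) by blast
      have *: "a \<in> {u \<in> P. w + n - k \<le> u}" using aP succ_ofD(2)[OF w(2)] by simp
      obtain b where b: "b \<in> {u \<in> P. w + n - k \<le> u}" "\<And>u. u \<in> {u \<in> P. w + n - k \<le> u} \<Longrightarrow> b \<le> u"
        using int_set_ex_least[OF *, of "w + n - k"] by blast
      have sb: "succ_of P w b" using b unfolding succ_of_def by auto
      have "b \<in> T" using sub startsI[OF wP sb] by blast
      then have "a \<le> b" using succ_ofD(3)[OF w(2)] b(1) by blast
      fix u assume "u \<in> P" "w + n - k \<le> u"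
      then show "a \<le> u" using b(2)[of u] \<open>a \<le> b\<close> by auto
    qed
    then show "a \<in> starts P" using startsI w(1) assms(3) by blast
  qed
  ultimately show ?thesis by blast
qed

lemma periodic_envelope:
  assumes "periodic T" shows "periodic (envelope T)"
proof -
  have *: "x + j * n \<in> envelope T" if x: "x \<in> envelope T" for x j
  proof -
    obtain r where r: "r \<in> T" "r \<le> x" "\<And>q. q \<in> T \<Longrightarrow> q + n - k \<le> r \<or> x - k \<le> q"
      using x unfolding envelope_def by blast
    have "q + n - k \<le> r + j * n \<or> x + j * n - k \<le> q" if "q \<in> T" for q
      using r(3)[of "q + (- j) * n"] periodic_mult[OF assms, of q "- j"] that by fastforce
    moreover have "r + j * n \<in> T" using r periodic_mult[OF assms] by blast
    moreover have "r + j * n \<le> x + j * n" using r(2) by simp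
    ultimately show ?thesis unfolding envelope_def by blast
  qed
  show ?thesis unfolding periodic_def
  proof (intro allI iffI)
    fix x
    show "x \<in> envelope T" if "x + n \<in> envelope T" using *[OF that, of "-1"] by simp
    show "x + n \<in> envelope T" if "x \<in> envelope T" using *[OF that, of 1] by simp
  qed
qed

section \<open>Fixed points of the envelope are residue classes\<close>

text \<open>\<open>starts T = T\<close> says that the successor map is onto. Modulo \<open>n\<close>
  it is a surjective self-map of a finite set, hence injective, and equivariance under shifts by
  \<open>n\<close> lifts this to the integers.\<close>

lemma succ_inj:
  assumes "periodic T" "starts T = T" "v \<in> T" "w \<in> T" "succ_of T v a" "succ_of T w a"
  shows "v = w"
proof -
  let ?S = "T \<inter> {0..<n}"
  define f where "f w = (THE a. succ_of T w a)" for w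
  have f: "f w = a" if "succ_of T w a" for w a
    unfolding f_def using that succ_unique by blast
  have "?S \<subseteq> (\<lambda>w. f w mod n) ` ?S"
  proof
    fix a assume a: "a \<in> ?S"
    then obtain w where w: "w \<in> T" "succ_of T w a" using assms(2) unfolding starts_def by blast
    have "succ_of T (w mod n) (a + (- (w div n)) * n)"
      using succ_shift[OF assms(1) w(2), of "- (w div n)"] by (simp add: minus_div_mult_eq_mod)
    then have "f (w mod n) mod n = (a + (- (w div n)) * n) mod n" using f by simp
    also have "\<dots> = a" using a by (subst mod_mult_self1) simp
    finally have "f (w mod n) mod n = a" .
    moreover have "w mod n \<in> ?S" using w periodic_mod[OF assms(1)] n_pos by auto
    ultimately show "a \<in> (\<lambda>w. f w mod n) ` ?S" by force
  qed
  then have inj: "inj_on (\<lambda>w. f w mod n) ?S"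
    by (meson endo_inj_surj finite_Int finite_atLeastLessThan_int finite_surj_inj)
  have g: "f (u mod n) mod n = a mod n" "u mod n \<in> ?S" if "u \<in> T" "succ_of T u a" for u
  proof -
    have "succ_of T (u mod n) (a + (- (u div n)) * n)"
      using succ_shift[OF assms(1) that(2), of "- (u div n)"] by (simp add: minus_div_mult_eq_mod)
    then have "f (u mod n) = a + (- (u div n)) * n" by (rule f)
    then show "f (u mod n) mod n = a mod n" by (metis mod_mult_self1 mult.commute)
    show "u mod n \<in> ?S" using that periodic_mod[OF assms(1)] n_pos by auto
  qed
  have "v mod n = w mod n"
    using inj_onD[OF inj] g[OF assms(3,5)] g[OF assms(4,6)] by metis
  then obtain j where j: "w = v + j * n"
    by (metis mod_eqE mult.commute)
  then have "succ_of T w (a + j * n)" using succ_shift[OF assms(1,5)] by simp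
  then have "a + j * n = a" using succ_unique assms(6) by blast
  then show ?thesis using j by simp
qed

definition coset :: "int \<Rightarrow> int set" where
  "coset c = {x. (n - 2 * k) dvd (x - c)}"

text \<open>Let \<open>e\<close> be the last element before the successor \<open>a\<close> of
  \<open>w\<close>. By injectivity every \<open>q < w\<close> has its successor strictly before
  \<open>a\<close>, hence at most \<open>e\<close>, so \<open>e\<close> witnesses that
  \<open>w + k\<close> lies in the envelope.\<close>

lemma envelope_fixed_shift:
  assumes "periodic T" "clique T" "starts T = T" "envelope T = T" "w \<in> T"
  shows "w + k \<in> T"
proof -
  obtain a where a: "succ_of T w a" using succ_ex[OF assms(1,5)] by blast
  have "w \<in> {u \<in> T. u < a}" using succ_ofD(2)[OF a] assms(5) k_less k_nonneg by auto
  then obtain e where e: "e \<in> {u \<in> T. u < a}" "\<And>u. u \<in> {u \<in> T. u < a} \<Longrightarrow> u \<le> e"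
    using int_set_ex_greatest[of w "{u \<in> T. u < a}" a] by (metis (no_types, lifting) less_imp_le mem_Collect_eq)
  have "e < w + n - k" using succ_ofD(3)[OF a, of e] e(1) by force
  then have ek: "e \<le> w + k" using cliqueD[OF assms(2), of e w] e(1) assms(5) by auto
  have "q + n - k \<le> e \<or> w + k - k \<le> q" if q: "q \<in> T" for q
  proof (cases "w \<le> q")
    case False
    obtain b where b: "succ_of T q b" using succ_ex[OF assms(1) q] by blast
    have "b \<le> a" using succ_mono[OF b a] False by simp
    moreover have "b \<noteq> a" using succ_inj[OF assms(1,3) q assms(5) b] a False by auto
    ultimately have "b \<le> e" using e(2) succ_ofD(1)[OF b] by auto
    then show ?thesis using succ_ofD(2)[OF b] by linarith
  qed simp
  then have "w + k \<in> envelope T" using ek e(1) unfolding envelope_def by blast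
  then show ?thesis using assms(4) by simp
qed

text \<open>Closure under adding \<open>k\<close> and periodicity give closure under all multiples
  of \<open>d = n - 2 * k\<close>; the clique condition excludes any further elements.\<close>

lemma envelope_fixed_imp_coset:
  assumes "periodic T" "clique T" "starts T = T" "envelope T = T" "w \<in> T"
  shows "(n - 2 * k) dvd k" "T = coset w"
proof -
  define d where "d = n - 2 * k"
  have dpos: "0 < d" using d_def k_less by simp
  have plus_k: "x + int j * k \<in> T" if "x \<in> T" for x j
  proof (induction j)
    case (Suc j)
    have "x + int (Suc j) * k = (x + int j * k) + k" by (simp add: algebra_simps)
    then show ?case using envelope_fixed_shift[OF assms(1-4) Suc] by metis
  qed (use that in simp)
  have minus_k: "x - k \<in> T" if "x \<in> T" for x
  proof -
    \<comment> \<open>Modulo \<open>n\<close>, subtracting \<open>k\<close> is the same as adding it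
      \<open>n - 1\<close> times.\<close>
    have "x + int (nat (n - 1)) * k = (x - k) + k * n" using n_pos by (simp add: algebra_simps)
    then show ?thesis using plus_k[OF that, of "nat (n - 1)"] periodic_mult[OF assms(1)] by metis
  qed
  have plus_d: "x + d \<in> T" if "x \<in> T" for x
  proof -
    have "x + d = (x - k - k) + n" by (simp add: d_def)
    then show ?thesis using minus_k[OF minus_k[OF that]] periodic_plus[OF assms(1)] by metis
  qed
  have minus_d: "x - d \<in> T" if "x \<in> T" for x
  proof -
    have "x - d = (x + int 2 * k) - n" by (simp add: d_def)
    then show ?thesis using plus_k[OF that, of 2] periodic_minus[OF assms(1)] by metis
  qed
  have mult_d: "x + int j * d \<in> T" "x - int j * d \<in> T" if "x \<in> T" for x j
  proof (induction j)
    case (Suc j)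
    case 1
    have "x + int (Suc j) * d = (x + int j * d) + d" by (simp add: algebra_simps)
    then show ?case using plus_d[OF Suc(1)] by metis
    case 2
    have "x - int (Suc j) * d = (x - int j * d) - d" by (simp add: algebra_simps)
    then show ?case using minus_d[OF Suc(2)] by metis
  qed (use that in simp_all)
  have mult_d': "x + j * d \<in> T" if "x \<in> T" for x j
    using mult_d(1)[OF that, of "nat j"] mult_d(2)[OF that, of "nat (- j)"] by (cases "0 \<le> j") auto
  have T: "d dvd (x - w)" if "x \<in> T" for x
  proof -
    \<comment> \<open>The element \<open>w + m + k\<close> of \<open>T\<close> is less than
      \<open>n - k\<close> beyond \<open>w\<close>, so it is at most \<open>k\<close> beyond it,
      which forces \<open>m = 0\<close>.\<close>
    define m where "m = (x - w) mod d"
    have m: "0 \<le> m" "m < d" using dpos m_def by auto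
    have "x + (- ((x - w) div d)) * d = w + m"
      using div_mult_mod_eq[of "x - w" d] by (simp add: m_def algebra_simps)
    then have "w + m \<in> T" using mult_d'[OF that] by metis
    then have "w + m + int 1 * k \<in> T" by (rule plus_k)
    then have "m \<le> 0" using cliqueD[OF assms(2) _ assms(5), of "w + m + k"] m d_def by simp
    then show ?thesis using m m_def by auto
  qed
  show "(n - 2 * k) dvd k" using T[OF envelope_fixed_shift[OF assms]] d_def by simp
  show "T = coset w" unfolding coset_def d_def[symmetric]
  proof (intro set_eqI iffI CollectI)
    fix x assume "x \<in> {x. d dvd x - w}"
    then obtain j where "x - w = d * j" by (auto elim: dvdE)
    then have "x = w + j * d" by (simp add: algebra_simps)
    then show "x \<in> T" using mult_d'[OF assms(5)] by blast
  qed (use T in blast)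
qed

lemma coset_fixed:
  assumes "(n - 2 * k) dvd k"
  shows "periodic (coset c)" "clique (coset c)" "starts (coset c) = coset c"
    "envelope (coset c) = coset c" "c \<in> coset c"
proof -
  define d where "d = n - 2 * k"
  have dpos: "0 < d" using d_def k_less by simp
  have dk: "d dvd k" using assms d_def by simp
  have nd: "n = 2 * k + d" using d_def by simp
  have dn: "d dvd n" using dk nd by simp
  have C: "x \<in> coset c \<longleftrightarrow> d dvd (x - c)" for x by (simp add: coset_def d_def)
  have shift: "x + y \<in> coset c \<longleftrightarrow> x \<in> coset c" if "d dvd y" for x y
  proof -
    have "x + y - c = (x - c) + y" by simp
    then show ?thesis using that C dvd_add_left_iff by metis
  qed
  have diff: "d dvd (x - y)" if "x \<in> coset c" "y \<in> coset c" for x y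
  proof -
    have "x - y = (x - c) - (y - c)" by simp
    then show ?thesis using that C dvd_diff by metis
  qed
  show per: "periodic (coset c)" unfolding periodic_def using shift dn by blast
  show cl: "clique (coset c)" unfolding clique_def
  proof (intro ballI)
    fix a w assume "a \<in> coset c" "w \<in> coset c"
    \<comment> \<open>A multiple of \<open>d\<close> is at most \<open>0\<close> or at least
      \<open>d\<close>, and \<open>k + d = n - k\<close>.\<close>
    then have "d dvd (a - w - k)" using diff dk dvd_diff by blast
    then show "a - w \<le> k \<or> n - k \<le> a - w"
      using zdvd_not_zless[of "a - w - k" d] nd by linarith
  qed
  show st: "starts (coset c) = coset c"
  proof
    show "coset c \<subseteq> starts (coset c)"
    proof
      fix a assume a: "a \<in> coset c"
      have "a + (k - n) \<in> coset c" using shift[of "k - n" a] dk dn a by simp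
      moreover have "succ_of (coset c) (a + (k - n)) a" unfolding succ_of_def using a by auto
      ultimately show "a \<in> starts (coset c)" by (rule startsI)
    qed
  qed (rule starts_subset)
  show "c \<in> coset c" by (simp add: C)
  show "envelope (coset c) = coset c"
  proof
    show "coset c \<subseteq> envelope (coset c)" using subset_envelope_starts[OF per cl] st by simp
    show "envelope (coset c) \<subseteq> coset c"
    proof
      fix x assume "x \<in> envelope (coset c)"
      then obtain r where r: "r \<in> coset c" "r \<le> x"
        "\<And>q. q \<in> coset c \<Longrightarrow> q + n - k \<le> r \<or> x - k \<le> q"
        unfolding envelope_def by blast
      \<comment> \<open>Testing the envelope condition at \<open>q = r - k\<close> leaves only
        \<open>x <= r\<close>, because \<open>q + n - k = r + d > r\<close>.\<close>
      have "r + (- k) \<in> coset c" using shift[of "- k" r] dk r(1) by simp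
      then have "x \<le> r" using r(3)[of "r + (- k)"] nd dpos by linarith
      then show "x \<in> coset c" using r by auto
    qed
  qed
qed

section \<open>Signed clique counts and the Euler characteristic\<close>

text \<open>The sign of the dimension of the simplex \<open>P\<close> modulo \<open>n\<close>; the
  exponent is raised by \<open>2\<close> to avoid truncated subtraction.\<close>

definition weight :: "int set \<Rightarrow> int" where
  "weight P = (-1) ^ (card (P \<inter> {0..<n}) + 1)"

definition cliques :: "int set set" where
  "cliques = {P. periodic P \<and> clique P \<and> P \<noteq> {}}"

lemma periodic_restrict:
  assumes "periodic P" shows "P = {x. x mod n \<in> P \<inter> {0..<n}}"
  using periodic_mod[OF assms] n_pos by auto

lemma periodic_extend: "periodic {x. x mod n \<in> I}"
  unfolding periodic_def by simp

lemma finite_periodic: "finite {P. periodic P}"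
proof (rule finite_imageD)
  show "finite ((\<lambda>P. P \<inter> {0..<n}) ` {P. periodic P})"
    by (rule finite_subset[of _ "Pow {0..<n}"]) auto
  show "inj_on (\<lambda>P. P \<inter> {0..<n}) {P. periodic P}"
    by (rule inj_onI) (metis mem_Collect_eq periodic_restrict)
qed

lemma finite_cliques: "finite cliques"
  by (rule finite_subset[OF _ finite_periodic]) (auto simp: cliques_def)

text \<open>A sign-reversing involution: a whole residue class is switched, so periodicity
  survives.\<close>

definition toggle :: "int \<Rightarrow> int set \<Rightarrow> int set" where
  "toggle x P = {y. (y \<in> P) \<noteq> (y mod n = x mod n)}"

lemma toggle_toggle: "toggle x (toggle x P) = P"
  unfolding toggle_def by auto

lemma periodic_toggle: "periodic P \<Longrightarrow> periodic (toggle x P)"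
  unfolding toggle_def periodic_def by simp

lemma weight_toggle:
  assumes "periodic P" shows "weight (toggle x P) = - weight P"
proof -
  define y where "y = x mod n"
  have y: "y \<in> {0..<n}" using n_pos by (simp add: y_def)
  have tog: "toggle x P \<inter> {0..<n} =
      (if y \<in> P then (P \<inter> {0..<n}) - {y} else insert y (P \<inter> {0..<n}))"
    using y unfolding toggle_def y_def by auto
  show ?thesis
  proof (cases "y \<in> P")
    case True
    then have "card (P \<inter> {0..<n}) = Suc (card ((P \<inter> {0..<n}) - {y}))"
      using y by (intro card.remove) auto
    then show ?thesis using True by (simp add: weight_def tog)
  next
    case False
    then show ?thesis by (simp add: weight_def tog)
  qed
qed

lemma starts_fibre:
  assumes "T \<in> starts ` cliques"
  shows "{P \<in> cliques. starts P = T} = {P. periodic P \<and> T \<subseteq> P \<and> P \<subseteq> envelope T}"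
    and "periodic T" "clique T" "T \<noteq> {}" "starts T = T" "T \<subseteq> envelope T"
proof -
  obtain Q where Q: "periodic Q" "clique Q" "Q \<noteq> {}" "T = starts Q"
    using assms unfolding cliques_def by blast
  show T: "periodic T" "clique T" "T \<noteq> {}" "starts T = T"
    using Q periodic_starts clique_starts starts_nonempty starts_starts by auto
  show "T \<subseteq> envelope T" using subset_envelope_starts[OF T(1,2)] T(4) by simp
  show "{P \<in> cliques. starts P = T} = {P. periodic P \<and> T \<subseteq> P \<and> P \<subseteq> envelope T}"
  proof (intro set_eqI iffI)
    fix P assume "P \<in> {P \<in> cliques. starts P = T}"
    then show "P \<in> {P. periodic P \<and> T \<subseteq> P \<and> P \<subseteq> envelope T}"
      using starts_subset subset_envelope_starts unfolding cliques_def by blast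
  next
    fix P assume P: "P \<in> {P. periodic P \<and> T \<subseteq> P \<and> P \<subseteq> envelope T}"
    then have "clique P" using clique_envelope[OF T(1)] unfolding clique_def by blast
    then show "P \<in> {P \<in> cliques. starts P = T}"
      using P T(3) starts_between[OF T(1,4)] unfolding cliques_def by blast
  qed
qed

text \<open>If the envelope is strictly larger than \<open>T\<close>, toggling a class in the
  difference pairs off the members of the fibre with opposite signs.\<close>

lemma starts_fibre_sum:
  assumes "T \<in> starts ` cliques"
  shows "(\<Sum>P | P \<in> cliques \<and> starts P = T. weight P) = (if envelope T = T then weight T else 0)"
proof (cases "envelope T = T")
  case True
  then have "{P \<in> cliques. starts P = T} = {T}"
    using starts_fibre(1,2)[OF assms] by auto
  then show ?thesis using True by simp
next
  case False
  define F where "F = {P. periodic P \<and> T \<subseteq> P \<and> P \<subseteq> envelope T}"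
  have perT: "periodic T" and perE: "periodic (envelope T)"
    using starts_fibre(2)[OF assms] periodic_envelope by auto
  obtain x where x: "x \<in> envelope T" "x \<notin> T" using False starts_fibre(6)[OF assms] by blast
  have tog: "toggle x P \<in> F" if "P \<in> F" for P
  proof -
    have "y \<in> envelope T" "y \<notin> T" if "y mod n = x mod n" for y
      using that x periodic_mod[OF perT] periodic_mod[OF perE] by metis+
    then show ?thesis using that periodic_toggle unfolding F_def toggle_def by auto
  qed
  have "sum weight F = (\<Sum>P\<in>F. - weight P)"
    by (rule sum.reindex_bij_witness[of _ "toggle x" "toggle x"])
       (use tog toggle_toggle weight_toggle in \<open>auto simp: F_def\<close>)
  then have "sum weight F = 0" by (simp add: sum_negf)
  then show ?thesis using False starts_fibre(1)[OF assms] by (simp add: F_def)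
qed

lemma fixed_starts_eq:
  "{T \<in> starts ` cliques. envelope T = T} =
     (if (n - 2 * k) dvd k then coset ` {0..<n - 2 * k} else {})"
proof -
  have d: "0 < n - 2 * k" using k_less by simp
  have 1: "(n - 2 * k) dvd k \<and> T \<in> coset ` {0..<n - 2 * k}"
    if T: "T \<in> starts ` cliques" "envelope T = T" for T
  proof -
    note fib = starts_fibre(2-5)[OF T(1)]
    obtain w where w: "w \<in> T" using fib(3) by blast
    note fx = envelope_fixed_imp_coset[OF fib(1,2,4) T(2) w]
    have "coset w = coset (w mod (n - 2 * k))"
      unfolding coset_def by (simp add: mod_eq_dvd_iff[symmetric])
    then show ?thesis using fx d by auto
  qed
  have 2: "T \<in> starts ` cliques \<and> envelope T = T"
    if "(n - 2 * k) dvd k" "T \<in> coset ` {0..<n - 2 * k}" for T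
    using that(2) coset_fixed[OF that(1)] unfolding cliques_def
    by (smt (verit, ccfv_threshold) empty_iff imageE image_eqI mem_Collect_eq)
  show ?thesis using 1 2 by auto
qed

lemma inj_on_coset: "inj_on coset {0..<n - 2 * k}"
proof (rule inj_onI)
  fix a b assume ab: "a \<in> {0..<n - 2 * k}" "b \<in> {0..<n - 2 * k}" "coset a = coset b"
  have "a \<in> coset a" by (simp add: coset_def)
  then have "a \<in> coset b" using ab(3) by simp
  then have "(n - 2 * k) dvd (a - b)" by (simp add: coset_def)
  then have "a mod (n - 2 * k) = b mod (n - 2 * k)" by (simp add: mod_eq_dvd_iff)
  then show "a = b" using ab(1,2) by simp
qed

text \<open>With \<open>k = d * l\<close> one has \<open>n = d * (2 * l + 1)\<close>, so each
  residue class meets a period in an odd number of points.\<close>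

lemma weight_coset:
  assumes "(n - 2 * k) dvd k" "c \<in> {0..<n - 2 * k}"
  shows "weight (coset c) = 1"
proof -
  define d where "d = n - 2 * k"
  have d: "0 < d" using k_less d_def by simp
  obtain l where l: "k = d * l" using assms(1) d_def by blast
  have "n = 2 * k + d" using d_def by simp
  then have n: "n = d * (2 * l + 1)" using l by (simp add: algebra_simps)
  have lpos: "0 \<le> l" using l k_nonneg d by (simp add: zero_le_mult_iff)
  have c: "0 \<le> c" "c < d" using assms(2) d_def by auto
  have "coset c \<inter> {0..<n} = (\<lambda>i. c + d * i) ` {0..<2 * l + 1}"
  proof (intro set_eqI iffI)
    fix x assume x: "x \<in> coset c \<inter> {0..<n}"
    then obtain i where "x - c = d * i" by (auto simp: coset_def d_def)
    then have i: "x = c + d * i" by simp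
    have "d * 0 < d * (i + 1)" using x i c by (simp add: algebra_simps)
    then have "0 \<le> i" using d by (simp add: zero_less_mult_iff)
    have "c + d * i < d * (2 * l + 1)" using x i n by simp
    then have "d * i < d * (2 * l + 1)" using c by linarith
    then have "i < 2 * l + 1" using d mult_less_cancel_left_pos by blast
    with \<open>0 \<le> i\<close> show "x \<in> (\<lambda>i. c + d * i) ` {0..<2 * l + 1}" using i by auto
  next
    fix x assume "x \<in> (\<lambda>i. c + d * i) ` {0..<2 * l + 1}"
    then obtain i where i: "x = c + d * i" "i \<in> {0..<2 * l + 1}" by blast
    have "d * i \<le> d * (2 * l)" using i(2) d by (intro mult_left_mono) auto
    moreover have "0 \<le> d * i" using i(2) d by simp
    moreover have "n = d * (2 * l) + d" using n by (simp add: algebra_simps)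
    ultimately have "0 \<le> x" "x < n" using i(1) c by linarith+
    then show "x \<in> coset c \<inter> {0..<n}" using i(1) by (simp add: coset_def d_def)
  qed
  moreover have "inj_on (\<lambda>i. c + d * i) {0..<2 * l + 1}" using d by (auto intro: inj_onI)
  ultimately have "card (coset c \<inter> {0..<n}) = nat (2 * l + 1)" by (simp add: card_image)
  also have "\<dots> = 2 * nat l + 1" using lpos by simp
  finally show ?thesis by (simp add: weight_def)
qed

lemma sum_weight_cliques:
  "(\<Sum>P\<in>cliques. weight P) = (if (n - 2 * k) dvd k then n - 2 * k else 0)"
proof -
  have "(\<Sum>P\<in>cliques. weight P) = (\<Sum>T\<in>starts ` cliques. \<Sum>P | P \<in> cliques \<and> starts P = T. weight P)"
    by (rule sum.image_gen[OF finite_cliques])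
  also have "\<dots> = (\<Sum>T\<in>starts ` cliques. if envelope T = T then weight T else 0)"
    by (rule sum.cong[OF refl starts_fibre_sum])
  also have "\<dots> = (\<Sum>T | T \<in> starts ` cliques \<and> envelope T = T. weight T)"
    by (rule sum.inter_filter[symmetric]) (simp add: finite_cliques)
  also have "\<dots> = (if (n - 2 * k) dvd k then n - 2 * k else 0)"
    using k_less weight_coset
    by (simp add: fixed_starts_eq sum.reindex[OF inj_on_coset])
  finally show ?thesis .
qed

lemma clique_iff_circ_clique:
  assumes "periodic P" shows "clique P \<longleftrightarrow> circ_clique n k (P \<inter> {0..<n})"
proof
  assume "clique P"
  then show "circ_clique n k (P \<inter> {0..<n})"
    unfolding circ_clique_def using cliqueD by (smt (verit) IntE)
next
  assume circ: "circ_clique n k (P \<inter> {0..<n})"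
  show "clique P" unfolding clique_def
  proof (intro ballI)
    fix a w assume aw: "a \<in> P" "w \<in> P"
    define a' w' j where "a' = a mod n" and "w' = w mod n" and "j = a div n - w div n"
    have a': "a' \<in> P \<inter> {0..<n}" and w': "w' \<in> P \<inter> {0..<n}"
      using aw periodic_mod[OF assms] n_pos by (auto simp: a'_def w'_def)
    have eq: "a - w = a' - w' + j * n"
      using div_mult_mod_eq[of a n] div_mult_mod_eq[of w n]
      unfolding a'_def w'_def j_def by (simp add: algebra_simps)
    have c: "\<bar>a' - w'\<bar> \<le> k \<or> n - k \<le> \<bar>a' - w'\<bar>"
      using circ a' w' unfolding circ_clique_def by blast
    \<comment> \<open>Outside \<open>j = 0\<close> and \<open>j = 1\<close> the difference is
      negative or exceeds \<open>n\<close>. For \<open>j = 1\<close> the condition on the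
      representatives is used through its symmetry under complement to \<open>n\<close>.\<close>
    consider "j \<le> - 1" | "j = 0" | "j = 1" | "2 \<le> j" by linarith
    then show "a - w \<le> k \<or> n - k \<le> a - w"
    proof cases
      case 1
      then have "j * n \<le> (- 1) * n" using n_pos by (intro mult_right_mono) auto
      then have "a - w \<le> 0" using eq a' w' by simp
      then show ?thesis using k_nonneg by simp
    next
      case 4
      then have "2 * n \<le> j * n" using n_pos by (intro mult_right_mono) auto
      moreover have "- n < a' - w'" using a' w' by auto
      ultimately have "n - k \<le> a - w" using eq k_nonneg by linarith
      then show ?thesis ..
    qed (use eq c a' w' in auto)
  qed
qed

text \<open>Restriction to one period is a bijection from the periodic cliques to the nonempty
  cliques of the circulant graph, and it carries \<open>weight\<close> to the sign of the
  simplex.\<close>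

lemma euler_characteristic:
  "(\<Sum>I | I \<noteq> {} \<and> I \<subseteq> {0..<n} \<and> circ_clique n k I. (-1) ^ (card I + 1)) =
     (if (n - 2 * k) dvd k then n - 2 * k else 0)"
proof -
  have restr: "{x. x mod n \<in> I} \<inter> {0..<n} = I" if "I \<subseteq> {0..<n}" for I
    using that by auto
  have "(\<Sum>I | I \<noteq> {} \<and> I \<subseteq> {0..<n} \<and> circ_clique n k I. (-1) ^ (card I + 1)) =
      (\<Sum>P\<in>cliques. weight P)"
  proof (rule sum.reindex_bij_witness[of _ "\<lambda>P. P \<inter> {0..<n}" "\<lambda>I. {x. x mod n \<in> I}"], goal_cases)
    case (1 I)
    then show ?case using restr by blast
  next
    case (2 I)
    then have "{x. x mod n \<in> I} \<noteq> {}" using restr by blast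
    then show ?case using 2 restr periodic_extend[of I] clique_iff_circ_clique[OF periodic_extend, of I]
      unfolding cliques_def by simp
  next
    case (3 P)
    then show ?case using periodic_restrict[of P] unfolding cliques_def by blast
  next
    case (4 P)
    then have P: "periodic P" "clique P" "P \<noteq> {}" unfolding cliques_def by auto
    then have "P \<inter> {0..<n} \<noteq> {}" using periodic_restrict[OF P(1)] by blast
    then show ?case using P clique_iff_circ_clique[OF P(1)] by simp
  next
    case (5 I)
    then show ?case using restr unfolding weight_def by simp
  qed
  then show ?thesis using sum_weight_cliques by simp
qed

end

section \<open>Cyclic width and diameters on the circle\<close>

text \<open>For nonempty index sets in \<open>{0..<int n}\<close> this is the largest cyclic
  distance. The bound \<open>n div 2\<close> always holds, so the \<open>LEAST\<close> is
  attained.\<close>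

definition circ_width :: "nat \<Rightarrow> int set \<Rightarrow> nat" where
  "circ_width n I = (LEAST k. circ_clique (int n) (int k) I)"

lemma circ_clique_mono: "circ_clique n k I \<Longrightarrow> k \<le> l \<Longrightarrow> circ_clique n l I"
  unfolding circ_clique_def by fastforce

lemma circ_clique_half: "circ_clique (int n) (int (n div 2)) I"
  unfolding circ_clique_def by auto

lemma circ_width_le_iff: "circ_width n I \<le> k \<longleftrightarrow> circ_clique (int n) (int k) I"
proof
  have "circ_clique (int n) (int (circ_width n I)) I"
    unfolding circ_width_def by (rule LeastI) (rule circ_clique_half)
  then show "circ_clique (int n) (int k) I" if "circ_width n I \<le> k"
    using that by (auto elim: circ_clique_mono)
qed (simp add: circ_width_def Least_le)

lemma circ_width_le_half: "circ_width n I \<le> n div 2"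
  by (simp add: circ_width_le_iff circ_clique_half)

definition cycle_point :: "nat \<Rightarrow> int \<Rightarrow> real ^ 2" where
  "cycle_point n i = vector [cos (2 * pi * of_int i / real n), sin (2 * pi * of_int i / real n)]"

lemma eucl_cycle_eq: "eucl_cycle n = cycle_point n ` {0..<int n}"
proof -
  have "{0..<int n} = int ` {..<n}"
    by (simp add: image_int_atLeastLessThan lessThan_atLeast0)
  then show ?thesis by (simp add: eucl_cycle_def cycle_point_def image_image)
qed

lemma dist_cycle_point:
  "dist (cycle_point n i) (cycle_point n j) = 2 * \<bar>sin (pi * of_int \<bar>i - j\<bar> / real n)\<bar>"
proof -
  define a b where "a = pi * of_int i / real n" and "b = pi * of_int j / real n"
  have pt: "cycle_point n i = vector [cos (2 * a), sin (2 * a)]"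
    "cycle_point n j = vector [cos (2 * b), sin (2 * b)]"
    by (simp_all add: cycle_point_def a_def b_def mult.assoc)
  have "(cos (2 * a) - cos (2 * b))\<^sup>2 + (sin (2 * a) - sin (2 * b))\<^sup>2
      = 2 - 2 * (cos (2 * a) * cos (2 * b) + sin (2 * a) * sin (2 * b))"
    using sin_cos_squared_add[of "2 * a"] sin_cos_squared_add[of "2 * b"]
    by (simp add: power2_eq_square algebra_simps)
  also have "\<dots> = 2 - 2 * cos (2 * (a - b))" by (simp add: cos_diff right_diff_distrib)
  also have "\<dots> = (2 * sin (a - b))\<^sup>2" by (simp only: cos_double_sin) (simp add: power2_eq_square)
  finally have "dist (cycle_point n i) (cycle_point n j) = 2 * \<bar>sin (a - b)\<bar>"
    by (simp add: pt dist_vec_def L2_set_def sum_2 dist_real_def real_sqrt_mult)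
  also have "a - b = pi * of_int (i - j) / real n"
    by (simp add: a_def b_def diff_divide_distrib right_diff_distrib)
  also have "\<bar>sin (pi * of_int (i - j) / real n)\<bar> = \<bar>sin (pi * of_int \<bar>i - j\<bar> / real n)\<bar>"
    by (cases "0 \<le> i - j") (simp_all add: abs_if minus_diff_eq[of i j, symmetric] del: minus_diff_eq of_int_diff)
  finally show ?thesis .
qed

lemma sin_le_sin_symmetric:
  assumes "0 \<le> x" "x \<le> y" "y \<le> pi - x" shows "sin x \<le> sin y"
proof (cases "y \<le> pi / 2")
  case True
  then show ?thesis using assms by (intro sin_monotone_2pi_le) auto
next
  case False
  then have "sin x \<le> sin (pi - y)" using assms by (intro sin_monotone_2pi_le) auto
  then show ?thesis by simp
qed

text \<open>The sine is symmetric about \<open>pi / 2\<close>, so on the index range from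
  \<open>i\<close> to \<open>n - i\<close> it is smallest at the ends. Thus chord length increases
  with cyclic distance.\<close>

lemma sin_cycle_mono:
  assumes "0 \<le> i" "i \<le> j" "j \<le> int n - i" "n > 0"
  shows "sin (pi * of_int i / real n) \<le> sin (pi * of_int j / real n)"
proof (rule sin_le_sin_symmetric)
  have "real_of_int j \<le> real n - real_of_int i" using assms(3) by linarith
  then have "pi * of_int j / real n \<le> pi * (real n - of_int i) / real n"
    by (intro divide_right_mono mult_left_mono) auto
  then show "pi * of_int j / real n \<le> pi - pi * of_int i / real n"
    using assms(4) by (simp add: field_simps)
qed (use assms in \<open>auto intro!: divide_right_mono mult_left_mono\<close>)

lemma sin_cycle_nonneg:
  assumes "0 \<le> i" "i \<le> int n" shows "0 \<le> sin (pi * of_int i / real n)"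
proof (cases "n = 0")
  case False
  then show ?thesis using sin_cycle_mono[of 0 i n] assms by simp
qed simp

lemma diameter_cycle:
  assumes "I \<noteq> {}" "I \<subseteq> {0..<int n}"
  shows "diameter (cycle_point n ` I) = 2 * sin (pi * real (circ_width n I) / real n)"
proof (rule antisym)
  define r where "r = circ_width n I"
  have n: "n > 0" using assms by (cases n) auto
  have r: "2 * r \<le> n" using circ_width_le_half[of n I] r_def by simp
  have sr: "0 \<le> sin (pi * real r / real n)" using sin_cycle_nonneg[of "int r" n] r by simp
  show "diameter (cycle_point n ` I) \<le> 2 * sin (pi * real (circ_width n I) / real n)"
    unfolding r_def[symmetric]
  proof (rule diameter_le)
    show "cycle_point n ` I \<noteq> {} \<or> 0 \<le> 2 * sin (pi * real r / real n)" using assms(1) by simp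
    fix p q assume "p \<in> cycle_point n ` I" "q \<in> cycle_point n ` I"
    then obtain a w where aw: "a \<in> I" "w \<in> I" "p = cycle_point n a" "q = cycle_point n w" by blast
    define m where "m = \<bar>a - w\<bar>"
    have "a \<in> {0..<int n}" "w \<in> {0..<int n}" using aw assms(2) by blast+
    then have m: "0 \<le> m" "m \<le> int n" unfolding m_def by auto
    have "circ_clique (int n) (int r) I" using circ_width_le_iff r_def by blast
    then have "m \<le> int r \<or> int n - int r \<le> m" using aw unfolding circ_clique_def m_def by blast
    then have "sin (pi * of_int m / real n) \<le> sin (pi * real r / real n)"
    proof
      assume "m \<le> int r"
      then show ?thesis using sin_cycle_mono[of m "int r" n] m n r by simp
    next
      assume h: "int n - int r \<le> m"
      have "pi * of_int (int n - m) / real n = pi - pi * of_int m / real n"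
        using n by (simp add: field_simps)
      then have "sin (pi * of_int m / real n) = sin (pi * of_int (int n - m) / real n)" by simp
      also have "\<dots> \<le> sin (pi * of_int (int r) / real n)"
        by (rule sin_cycle_mono) (use h m n r in auto)
      finally show ?thesis by simp
    qed
    then show "norm (p - q) \<le> 2 * sin (pi * real r / real n)"
      using sin_cycle_nonneg[OF m]
      by (simp add: aw dist_norm[symmetric] dist_cycle_point m_def[symmetric] del: of_int_abs)
  qed
  show "2 * sin (pi * real (circ_width n I) / real n) \<le> diameter (cycle_point n ` I)"
    unfolding r_def[symmetric]
  proof -
    have fin: "finite I" by (rule finite_subset[OF assms(2)]) simp
    then have bdd: "bounded (cycle_point n ` I)" by (simp add: finite_imp_bounded)
    show "2 * sin (pi * real r / real n) \<le> diameter (cycle_point n ` I)"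
    proof (cases "r = 0")
      case True
      then show ?thesis using diameter_ge_0[OF bdd] by simp
    next
      case False
      \<comment> \<open>Minimality of \<open>r > 0\<close> supplies a pair violating the bound
        \<open>r - 1\<close>; its index difference lies between \<open>r\<close> and
        \<open>n - r\<close>, so its chord is long enough.\<close>
      then have "\<not> circ_width n I \<le> r - 1" by (simp add: r_def)
      then have "\<not> circ_clique (int n) (int (r - 1)) I" by (simp only: circ_width_le_iff not_False_eq_True)
      then obtain a w where aw: "a \<in> I" "w \<in> I" "\<not> \<bar>a - w\<bar> \<le> int (r - 1)"
        "\<not> int n - int (r - 1) \<le> \<bar>a - w\<bar>"
        unfolding circ_clique_def by blast
      define m where "m = \<bar>a - w\<bar>"
      have m: "int r \<le> m" "m \<le> int n - int r" using aw False m_def by linarith+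
      have "2 * sin (pi * real r / real n) \<le> 2 * sin (pi * of_int m / real n)"
        using sin_cycle_mono[of "int r" m n] m n by simp
      also have "\<dots> \<le> dist (cycle_point n a) (cycle_point n w)"
        by (simp add: dist_cycle_point m_def[symmetric] del: of_int_abs)
      also have "\<dots> \<le> diameter (cycle_point n ` I)"
        by (rule diameter_bounded_bound[OF bdd]) (use aw in auto)
      finally show ?thesis .
    qed
  qed
qed

lemma inj_on_cycle_point: "inj_on (cycle_point n) {0..<int n}"
proof (rule inj_onI)
  fix i j assume ij: "i \<in> {0..<int n}" "j \<in> {0..<int n}" "cycle_point n i = cycle_point n j"
  have n: "n > 0" using ij by (cases n) auto
  show "i = j"
  proof (rule ccontr)
    assume "i \<noteq> j"
    define m where "m = \<bar>i - j\<bar>"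
    have m: "0 < m" "m < int n" using ij \<open>i \<noteq> j\<close> m_def by auto
    have "0 < pi * of_int m / real n" using m n by simp
    moreover have "real_of_int m < real n" using m by linarith
    then have "pi * of_int m / real n < pi" using n by (simp add: field_simps)
    ultimately have "0 < sin (pi * of_int m / real n)" by (rule sin_gt_zero)
    moreover have "dist (cycle_point n i) (cycle_point n j) = 0" using ij by simp
    ultimately show False by (simp add: dist_cycle_point m_def[symmetric] del: of_int_abs)
  qed
qed

section \<open>The Rips magnitude of a cycle by summation by parts\<close>

definition level :: "nat \<Rightarrow> real \<Rightarrow> nat \<Rightarrow> real" where
  "level n t r = exp (- (2 * sin (pi * real r / real n) * t))"

lemma alternating_sum_nonempty_subsets:
  assumes "finite S" "S \<noteq> {}"
  shows "(\<Sum>I | I \<noteq> {} \<and> I \<subseteq> S. (-1) ^ (card I + 1)) = (1::int)"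
proof -
  \<comment> \<open>Expanding a product of vanishing factors gives the signed sum over all
    subsets.\<close>
  have "(\<Sum>I\<in>Pow S. (-1) ^ card I) = (\<Prod>x\<in>S. (-1) + (1::int))"
    using assms(1) by (simp only: prod_add) simp
  then have "(\<Sum>I\<in>Pow S. (-1) ^ card I) = (0::int)" using assms by (simp add: card_gt_0_iff)
  moreover have "Pow S = insert {} {I. I \<noteq> {} \<and> I \<subseteq> S}" by auto
  moreover have "finite {I. I \<noteq> {} \<and> I \<subseteq> S}" using assms(1) by simp
  ultimately have "1 + (\<Sum>I | I \<noteq> {} \<and> I \<subseteq> S. (-1) ^ card I) = (0::int)" by simp
  then show ?thesis by (simp add: sum_negf)
qed

text \<open>The indicator keeps the range of \<open>k\<close> independent of \<open>r\<close>, so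
  that this sum can be exchanged with the sum over simplices.\<close>

lemma telescope_from:
  fixes f :: "nat \<Rightarrow> real"
  assumes "r \<le> K"
  shows "f r = f K + (\<Sum>k<K. if r \<le> k then f k - f (Suc k) else 0)"
  using assms
proof (induction K)
  case (Suc K)
  show ?case
  proof (cases "r \<le> K")
    case False
    then have "r = Suc K" using Suc by simp
    then show ?thesis by simp
  qed (use Suc in simp)
qed simp

text \<open>Telescoping in the width turns the sum over simplices into one over thresholds
  \<open>k\<close>, each drop of \<open>level\<close> being multiplied by the Euler characteristic
  of the clique complex at \<open>k\<close>. Stopping at \<open>n div 2\<close> keeps
  \<open>2 * k < n\<close>; there the complex is a full simplex, of characteristic
  \<open>1\<close>.\<close>

lemma rips_eucl_cycle:
  assumes "n \<ge> 1"
  shows "rips_magnitude (eucl_cycle n) t = level n t (n div 2) +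
     (\<Sum>k<n div 2. if (n - 2 * k) dvd k
        then real (n - 2 * k) * (level n t k - level n t (Suc k)) else 0)"
proof -
  define S where "S = {I. I \<noteq> {} \<and> I \<subseteq> {0..<int n}}"
  define E where "E = level n t"
  define K where "K = n div 2"
  define \<sigma> :: "int set \<Rightarrow> real" where "\<sigma> I = of_int ((-1) ^ (card I + 1))" for I
  have finS: "finite S" unfolding S_def by simp
  have "rips_magnitude (eucl_cycle n) t = (\<Sum>I\<in>S. \<sigma> I * E (circ_width n I))"
    unfolding rips_magnitude_def
  proof (rule sum.reindex_bij_betw[symmetric, THEN trans])
    show "bij_betw (image (cycle_point n)) S {A. A \<noteq> {} \<and> A \<subseteq> eucl_cycle n}"
      unfolding bij_betw_def
    proof
      show "inj_on (image (cycle_point n)) S"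
        by (rule inj_on_subset[OF inj_on_image_Pow[OF inj_on_cycle_point]]) (auto simp: S_def)
      show "image (cycle_point n) ` S = {A. A \<noteq> {} \<and> A \<subseteq> eucl_cycle n}"
        by (auto simp: S_def eucl_cycle_eq image_iff subset_image_iff)
    qed
    show "(\<Sum>I\<in>S. (-1) ^ (card (cycle_point n ` I) - 1) * exp (- (diameter (cycle_point n ` I) * t))) =
        (\<Sum>I\<in>S. \<sigma> I * E (circ_width n I))"
    proof (rule sum.cong[OF refl])
      fix I assume I: "I \<in> S"
      then have fin: "finite I" and ne: "I \<noteq> {}" and sub: "I \<subseteq> {0..<int n}"
        using finite_subset[of I "{0..<int n}"] unfolding S_def by auto
      have "card (cycle_point n ` I) = card I"
        by (rule card_image[OF inj_on_subset[OF inj_on_cycle_point sub]])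
      moreover obtain c where "card I = Suc c" using fin ne by (metis card_0_eq not0_implies_Suc)
      ultimately show "(-1) ^ (card (cycle_point n ` I) - 1) * exp (- (diameter (cycle_point n ` I) * t)) =
          \<sigma> I * E (circ_width n I)"
        by (simp add: \<sigma>_def E_def level_def diameter_cycle[OF ne sub])
    qed
  qed
  also have "\<dots> = (\<Sum>I\<in>S. \<sigma> I * (E K + (\<Sum>k<K. if circ_width n I \<le> k then E k - E (Suc k) else 0)))"
    by (intro sum.cong refl arg_cong2[where f = "(*)"] telescope_from) (simp add: K_def circ_width_le_half)
  also have "\<dots> = E K * (\<Sum>I\<in>S. \<sigma> I) +
      (\<Sum>k<K. \<Sum>I\<in>S. \<sigma> I * (if circ_width n I \<le> k then E k - E (Suc k) else 0))"
    by (simp only: distrib_left sum.distrib sum_distrib_left sum.swap[of _ S] mult.commute[of "E K"])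
  also have "(\<Sum>I\<in>S. \<sigma> I) = 1"
    unfolding \<sigma>_def S_def of_int_sum[symmetric]
    by (subst alternating_sum_nonempty_subsets) (use assms in auto)
  also have "(\<Sum>k<K. \<Sum>I\<in>S. \<sigma> I * (if circ_width n I \<le> k then E k - E (Suc k) else 0)) =
      (\<Sum>k<K. if (n - 2 * k) dvd k then real (n - 2 * k) * (E k - E (Suc k)) else 0)"
  proof (rule sum.cong[OF refl])
    fix k assume "k \<in> {..<K}"
    then have k: "2 * k < n" unfolding K_def by auto
    interpret circulant "int n" "int k" by unfold_locales (use k in auto)
    have "(\<Sum>I\<in>S. \<sigma> I * (if circ_width n I \<le> k then E k - E (Suc k) else 0)) =
        (\<Sum>I\<in>S. if circ_clique (int n) (int k) I then \<sigma> I * (E k - E (Suc k)) else 0)"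
      by (rule sum.cong) (auto simp: circ_width_le_iff)
    also have "\<dots> = (\<Sum>I | I \<in> S \<and> circ_clique (int n) (int k) I. \<sigma> I * (E k - E (Suc k)))"
      by (rule sum.inter_filter[symmetric, OF finS])
    also have "\<dots> = of_int (\<Sum>I | I \<noteq> {} \<and> I \<subseteq> {0..<int n} \<and> circ_clique (int n) (int k) I.
        (-1) ^ (card I + 1)) * (E k - E (Suc k))"
      unfolding S_def \<sigma>_def by (simp add: sum_distrib_right conj_assoc)
    also have "(\<Sum>I | I \<noteq> {} \<and> I \<subseteq> {0..<int n} \<and> circ_clique (int n) (int k) I. (-1) ^ (card I + 1)) =
        (if int (n - 2 * k) dvd int k then int (n - 2 * k) else 0)"
      using k by (subst euler_characteristic) (simp add: of_nat_diff)
    finally show "(\<Sum>I\<in>S. \<sigma> I * (if circ_width n I \<le> k then E k - E (Suc k) else 0)) =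
        (if (n - 2 * k) dvd k then real (n - 2 * k) * (E k - E (Suc k)) else 0)"
      by (simp only: of_nat_dvd_iff) simp
  qed
  finally show ?thesis unfolding E_def K_def by simp
qed

section \<open>The limiting series and the upper bound\<close>

text \<open>Up to the factor \<open>2 * pi * t\<close>, this is \<open>pi / q\<close> times the
  descent rate of \<open>exp (- (2 * sin x * t))\<close> at
  \<open>x = pi / 2 - pi / (2 * q)\<close>. At \<open>q = 0\<close> division by zero makes it
  \<open>0\<close>.\<close>

definition limit_term :: "real \<Rightarrow> nat \<Rightarrow> real" where
  "limit_term t q = 1 / real q * exp (- 2 * t * cos (pi / (2 * real q))) * sin (pi / (2 * real q))"

lemma half_angle_bounds:
  fixes q :: nat
  assumes "q \<ge> 1"
  shows "0 \<le> sin (pi / (2 * real q))" "0 \<le> cos (pi / (2 * real q))"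
proof -
  have "pi / (2 * real q) \<le> pi / 2" using assms by (intro divide_left_mono) auto
  moreover have "0 \<le> pi / (2 * real q)" by simp
  ultimately show "0 \<le> sin (pi / (2 * real q))" "0 \<le> cos (pi / (2 * real q))"
    using pi_gt_zero by (intro sin_ge_zero cos_ge_zero; linarith)+
qed

lemma limit_term_nonneg: "0 \<le> limit_term t q"
  using half_angle_bounds(1)[of q] by (cases "q = 0") (simp_all add: limit_term_def)

lemma limit_term_summable:
  assumes "t > 0" shows "limit_term t summable_on A"
proof -
  have bound: "norm (limit_term t q) \<le> pi / 2 * (1 / real q ^ 2)" for q
  proof (cases "q = 0")
    case False
    then have "0 \<le> cos (pi / (2 * real q))" by (intro half_angle_bounds) simp
    then have "exp (- 2 * t * cos (pi / (2 * real q))) \<le> 1" using assms by simp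
    moreover have "0 \<le> sin (pi / (2 * real q))" "sin (pi / (2 * real q)) \<le> pi / (2 * real q)"
      using half_angle_bounds(1)[of q] False by (auto intro!: sin_x_le_x)
    ultimately have "exp (- 2 * t * cos (pi / (2 * real q))) * sin (pi / (2 * real q))
        \<le> 1 * (pi / (2 * real q))"
      by (intro mult_mono) auto
    then have "limit_term t q \<le> 1 / real q * (1 * (pi / (2 * real q)))"
      unfolding limit_term_def mult.assoc by (intro mult_left_mono) auto
    then show ?thesis using limit_term_nonneg[of t q] by (simp add: power2_eq_square)
  qed (simp add: limit_term_def)
  have "summable (\<lambda>q. pi / 2 * (1 / real q ^ 2))"
    using inverse_power_summable[of 2, where 'a = real] by (intro summable_mult) (simp add: inverse_eq_divide)
  then have "summable (\<lambda>q. norm (limit_term t q))"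
    by (rule summable_comparison_test'[where N = 0]) (use bound in auto)
  then have "limit_term t summable_on UNIV" by (rule norm_summable_imp_summable_on)
  then show ?thesis by (rule summable_on_subset_banach) simp
qed

text \<open>Two tangent estimates combine: \<open>sin (x + \<delta>)\<close> is at most
  \<open>sin x + \<delta> * cos x\<close>, and the exponential lies above its tangent at
  \<open>0\<close>.\<close>

lemma exp_sin_tangent:
  assumes "t > 0" "0 \<le> x" "0 \<le> \<delta>" "x \<le> pi / 2"
  shows "exp (- (2 * sin x * t)) - exp (- (2 * sin (x + \<delta>) * t))
      \<le> \<delta> * (2 * t * cos x * exp (- (2 * sin x * t)))"
proof -
  define u v where "u = 2 * sin x * t" and "v = 2 * sin (x + \<delta>) * t"
  have sc: "0 \<le> sin x" "0 \<le> cos x" using assms by (auto intro!: sin_ge_zero cos_ge_zero)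
  have "sin (x + \<delta>) = sin x * cos \<delta> + cos x * sin \<delta>" by (rule sin_add)
  also have "\<dots> \<le> sin x * 1 + cos x * \<delta>"
    using sc assms by (intro add_mono mult_left_mono sin_x_le_x) auto
  finally have "2 * t * sin (x + \<delta>) \<le> 2 * t * (sin x + cos x * \<delta>)"
    using assms(1) by (intro mult_left_mono) auto
  then have vu: "v - u \<le> \<delta> * (2 * t * cos x)" by (simp add: u_def v_def algebra_simps)
  have "1 + - (v - u) \<le> exp (- (v - u))" by (rule exp_ge_add_one_self)
  then have "1 - exp (- (v - u)) \<le> \<delta> * (2 * t * cos x)" using vu by linarith
  then have "exp (- u) * (1 - exp (- (v - u))) \<le> exp (- u) * (\<delta> * (2 * t * cos x))"
    by (intro mult_left_mono) auto
  also have "exp (- u) * (1 - exp (- (v - u))) = exp (- u) - exp (- v)"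
    by (simp add: right_diff_distrib exp_add[symmetric])
  finally show ?thesis by (simp add: u_def v_def mult_ac)
qed

text \<open>The hypotheses give \<open>k / n = 1 / 2 - 1 / (2 * q)\<close>. They are stated over the
  reals to avoid truncated subtraction and cover both \<open>d = n - 2 * k\<close> and the case
  \<open>d = 1\<close>, \<open>q = n\<close>.\<close>

lemma level_eq:
  assumes "real q * real d = real n" "real n = 2 * real k + real d" "n > 0"
  shows "pi * real k / real n = pi / 2 - pi / (2 * real q)"
    and "cos (pi * real k / real n) = sin (pi / (2 * real q))"
    and "sin (pi * real k / real n) = cos (pi / (2 * real q))"
proof -
  have "real q * real d \<noteq> 0" unfolding assms(1) using assms(3) by simp
  then have nz: "real q \<noteq> 0" "real d \<noteq> 0" by auto
  have "2 * real k = real d * (real q - 1)" using assms by (simp add: algebra_simps)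
  then have k: "real k = real d * (real q - 1) / 2" by simp
  show *: "pi * real k / real n = pi / 2 - pi / (2 * real q)"
    unfolding k assms(1)[symmetric] using nz by (simp add: field_simps)
  show "cos (pi * real k / real n) = sin (pi / (2 * real q))"
    "sin (pi * real k / real n) = cos (pi / (2 * real q))"
    unfolding * by (simp_all add: cos_diff sin_diff)
qed

lemma critical_quotient:
  assumes "2 * k < n" "(n - 2 * k) dvd k"
  shows "odd (n div (n - 2 * k))" "real (n div (n - 2 * k)) * real (n - 2 * k) = real n"
proof -
  define d where "d = n - 2 * k"
  obtain l where l: "k = d * l" using assms(2) by (auto simp: d_def)
  have "n = 2 * k + d" using assms(1) by (simp add: d_def)
  then have "n = d * (2 * l + 1)" using l by (simp add: algebra_simps)
  then have n: "n = (n - 2 * k) * (2 * l + 1)" by (simp only: d_def)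
  then have "n div (n - 2 * k) = 2 * l + 1"
    using assms(1) by (metis nonzero_mult_div_cancel_left zero_less_diff less_numeral_extra(3))
  then show "odd (n div (n - 2 * k))" "real (n div (n - 2 * k)) * real (n - 2 * k) = real n"
    using n by (simp, metis mult.commute of_nat_mult \<open>n div (n - 2 * k) = 2 * l + 1\<close>)
qed

text \<open>One step in \<open>k\<close> moves the angle by \<open>pi / n\<close>; multiplied by
  \<open>d = n - 2 * k\<close> this becomes \<open>pi / q\<close>, the factor in the series
  term.\<close>

lemma level_drop_le:
  assumes "t > 0" "2 * k < n" "(n - 2 * k) dvd k"
  shows "real (n - 2 * k) * (level n t k - level n t (Suc k)) \<le> 2 * pi * t * limit_term t (n div (n - 2 * k))"
proof -
  define d q x where "d = n - 2 * k" and "q = n div (n - 2 * k)" and "x = pi * real k / real n"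
  have n: "real n = 2 * real k + real d" using assms(2) by (simp add: d_def of_nat_diff)
  have qd: "real q * real d = real n" using critical_quotient[OF assms(2,3)] by (simp add: q_def d_def)
  have npos: "n > 0" using assms(2) by simp
  note leq = level_eq[OF qd n npos, folded x_def]
  have x: "0 \<le> x" "x \<le> pi / 2" unfolding leq(1) by (simp add: x_def flip: leq(1)) simp
  have dn: "real d / real n = 1 / real q" unfolding qd[symmetric] using assms(2) by (simp add: d_def)
  have suc: "pi * real (Suc k) / real n = x + pi / real n"
    by (simp add: x_def add_divide_distrib distrib_left)
  have "level n t k - level n t (Suc k) \<le>
      pi / real n * (2 * t * cos x * exp (- (2 * sin x * t)))"
    unfolding level_def suc x_def[symmetric] by (rule exp_sin_tangent[OF assms(1) x(1) _ x(2)]) simp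
  then have "real d * (level n t k - level n t (Suc k)) \<le>
      real d * (pi / real n * (2 * t * cos x * exp (- (2 * sin x * t))))"
    by (intro mult_left_mono) auto
  also have "\<dots> = 2 * pi * t * (real d / real n) * exp (- (2 * sin x * t)) * cos x" by simp
  also have "\<dots> = 2 * pi * t * limit_term t q"
    unfolding dn leq(2,3) by (simp add: limit_term_def mult_ac)
  finally show ?thesis by (simp add: d_def q_def)
qed

text \<open>For odd \<open>n\<close> the last angle is \<open>pi / (2 * n)\<close> short of
  \<open>pi / 2\<close>. The tangent estimate over this half step costs half of the series term for
  \<open>q = n\<close>.\<close>

lemma level_half_le:
  assumes "t > 0" "n \<ge> 1"
  shows "level n t (n div 2) \<le> exp (- 2 * t) + (if odd n then 2 * pi * t * limit_term t n else 0)"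
proof (cases "odd n")
  case False
  then obtain m where "n = 2 * m" by blast
  then show ?thesis using assms by (simp add: level_def)
next
  case True
  define k x where "k = n div 2" and "x = pi * real k / real n"
  have n: "real n = 2 * real k + real 1" using True by (auto simp: k_def elim!: oddE)
  have npos: "n > 0" using assms by simp
  note leq = level_eq[OF _ n npos, of n, simplified, folded x_def]
  have x: "0 \<le> x" "x \<le> pi / 2" unfolding leq(1) by (simp add: x_def flip: leq(1)) simp
  have "x + pi / (2 * real n) = pi / 2" using leq(1) by simp
  moreover have "exp (- (2 * sin x * t)) - exp (- (2 * sin (x + pi / (2 * real n)) * t))
      \<le> pi / (2 * real n) * (2 * t * cos x * exp (- (2 * sin x * t)))"
    by (rule exp_sin_tangent) (use assms x in auto)
  ultimately have "level n t k - exp (- 2 * t)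
      \<le> pi / (2 * real n) * (2 * t * cos x * exp (- (2 * sin x * t)))"
    by (simp only: level_def x_def[symmetric]) simp
  also have "\<dots> = pi * t * limit_term t n"
    unfolding leq(2,3) by (simp add: limit_term_def mult_ac)
  also have "\<dots> \<le> 2 * pi * t * limit_term t n"
    using assms(1) limit_term_nonneg[of t n] by simp
  finally show ?thesis using True k_def by simp
qed

lemma rips_eucl_cycle_le:
  assumes "t > 0" "n \<ge> 1"
  shows "rips_magnitude (eucl_cycle n) t \<le> exp (- 2 * t) + 2 * pi * t * infsum (limit_term t) {q. odd q}"
proof -
  define K q where "K = n div 2" and "q k = n div (n - 2 * k)" for k
  define G where "G = {k. 2 * k < n \<and> (n - 2 * k) dvd k}"
  define b where "b k = 2 * pi * t * limit_term t (q k)" for k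
  have finG: "finite G" by (rule finite_subset[of _ "{..n}"]) (auto simp: G_def)
  have b0: "0 \<le> b k" for k using assms(1) limit_term_nonneg[of t] by (simp add: b_def)
  have "(\<Sum>k<K. if (n - 2 * k) dvd k then real (n - 2 * k) * (level n t k - level n t (Suc k)) else 0)
      = (\<Sum>k | k \<in> {..<K} \<and> (n - 2 * k) dvd k. real (n - 2 * k) * (level n t k - level n t (Suc k)))"
    by (rule sum.inter_filter[symmetric]) simp
  also have "\<dots> \<le> (\<Sum>k | k \<in> {..<K} \<and> (n - 2 * k) dvd k. b k)"
    unfolding b_def q_def by (rule sum_mono) (auto intro!: level_drop_le assms(1) simp: K_def)
  \<comment> \<open>For odd \<open>n\<close> the index \<open>K\<close>, with quotient
    \<open>n\<close>, is in \<open>G\<close> but outside the sum; its series term is left to absorb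
    the excess of \<open>level n t K\<close>.\<close>
  also have "{k. k \<in> {..<K} \<and> (n - 2 * k) dvd k} = (if odd n then G - {K} else G)"
    by (auto simp: G_def K_def elim!: oddE evenE)
  finally have "rips_magnitude (eucl_cycle n) t \<le> level n t K + (\<Sum>k\<in>(if odd n then G - {K} else G). b k)"
    unfolding rips_eucl_cycle[OF assms(2)] K_def[symmetric] by simp
  also have "\<dots> \<le> exp (- 2 * t) + (\<Sum>k\<in>G. b k)"
  proof (cases "odd n")
    case True
    then have "n - 2 * K = 1" by (auto simp: K_def elim!: oddE)
    then have "K \<in> G" "q K = n" by (auto simp: G_def q_def)
    then have "(\<Sum>k\<in>G. b k) = 2 * pi * t * limit_term t n + (\<Sum>k\<in>G - {K}. b k)"
      using sum.remove[OF finG, of K b] by (simp add: b_def)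
    then show ?thesis using level_half_le[OF assms] True K_def by simp
  qed (use level_half_le[OF assms] K_def in simp)
  also have "(\<Sum>k\<in>G. b k) \<le> 2 * pi * t * infsum (limit_term t) {q. odd q}"
  proof -
    \<comment> \<open>The quotient determines \<open>n - 2 * k\<close>, hence \<open>k\<close>, so
      no series term is used twice.\<close>
    have inj: "inj_on q G"
    proof (rule inj_onI)
      fix k l assume kl: "k \<in> G" "l \<in> G" "q k = q l"
      have "real (q k) * real (n - 2 * k) = real n" "real (q l) * real (n - 2 * l) = real n"
        unfolding q_def using kl(1,2) by (auto simp: G_def intro!: critical_quotient(2) simp del: of_nat_diff)
      then have "real (n - 2 * k) = real (n - 2 * l)" using kl(3) assms(2)
        by (metis mult_cancel_left mult_zero_left of_nat_0_eq_iff not_one_le_zero)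
      then show "k = l" using kl by (auto simp: G_def)
    qed
    have "(\<Sum>k\<in>G. b k) = 2 * pi * t * sum (limit_term t) (q ` G)"
      by (simp add: b_def sum.reindex[OF inj] sum_distrib_left)
    also have "sum (limit_term t) (q ` G) \<le> infsum (limit_term t) {q. odd q}"
      by (rule finite_sum_le_infsum)
         (use assms(1) limit_term_summable finG limit_term_nonneg critical_quotient(1) in \<open>auto simp: G_def q_def\<close>)
    finally show ?thesis using assms(1) by simp
  qed
  finally show ?thesis by simp
qed

section \<open>The lower bound along even cycle lengths with many divisors\<close>

lemma level_antimono:
  assumes "t > 0" "2 * Suc k \<le> n" shows "level n t (Suc k) \<le> level n t k"
proof -
  have "sin (pi * real_of_int (int k) / real n) \<le> sin (pi * real_of_int (int (Suc k)) / real n)"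
    by (rule sin_cycle_mono) (use assms in auto)
  then show ?thesis unfolding level_def using assms(1) by simp
qed

text \<open>The contribution of the quotient \<open>q\<close>, with \<open>k\<close> eliminated:
  \<open>n / q\<close> stands for \<open>n - 2 * k\<close>. In this form \<open>q\<close> can be
  held fixed while \<open>n\<close> grows.\<close>

definition finite_drop :: "real \<Rightarrow> nat \<Rightarrow> nat \<Rightarrow> real" where
  "finite_drop t q n = real n / real q *
     (exp (- (2 * sin (pi / 2 - pi / (2 * real q)) * t)) -
      exp (- (2 * sin (pi / 2 - pi / (2 * real q) + pi / real n) * t)))"

text \<open>Even length makes the leading term exactly \<open>exp (- 2 * t)\<close>. Each
  \<open>q\<close> in \<open>F\<close> accounts for one summand, and the remaining summands are
  nonnegative.\<close>

lemma rips_eucl_cycle_ge: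
  assumes "t > 0" "finite F" "\<And>q. q \<in> F \<Longrightarrow> odd q \<and> q dvd m" "m > 0"
  shows "exp (- 2 * t) + (\<Sum>q\<in>F. finite_drop t q (2 * m)) \<le> rips_magnitude (eucl_cycle (2 * m)) t"
proof -
  define n where "n = 2 * m"
  define T where "T k = (if (n - 2 * k) dvd k
      then real (n - 2 * k) * (level n t k - level n t (Suc k)) else 0)" for k
  \<comment> \<open>This solves \<open>n - 2 * k = n / q\<close>. With \<open>m = q * e\<close> and
    \<open>q = 2 * l + 1\<close> it equals \<open>2 * l * e\<close>, a multiple of
    \<open>n - 2 * k = 2 * e\<close>.\<close>
  define \<kappa> where "\<kappa> q = m - m div q" for q
  have \<kappa>: "\<kappa> q < m" "T (\<kappa> q) = finite_drop t q n" "m = q * (m - \<kappa> q)" if "q \<in> F" for q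
  proof -
    have q: "odd q" "q dvd m" using assms(3)[OF that] by auto
    obtain e where e: "m = q * e" using q(2) by blast
    obtain l where l: "q = 2 * l + 1" using q(1) by (rule oddE)
    have epos: "e > 0" using e assms(4) by simp
    have "m div q = e" unfolding e using l by (intro nonzero_mult_div_cancel_left) simp
    then have k: "\<kappa> q = 2 * l * e" using e l by (simp add: \<kappa>_def algebra_simps)
    have d: "n - 2 * \<kappa> q = 2 * e" using e l k by (simp add: n_def algebra_simps)
    have dvd: "(n - 2 * \<kappa> q) dvd \<kappa> q" unfolding d by (simp add: k)
    show "\<kappa> q < m" using k e l epos by simp
    show "m = q * (m - \<kappa> q)" using k e l by (simp add: algebra_simps)
    have "real q * real (2 * e) = real n" "real n = 2 * real (\<kappa> q) + real (2 * e)"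
      using e l k by (simp_all add: n_def algebra_simps)
    note eqs = this
    have npos: "n > 0" using assms(4) by (simp add: n_def)
    note leq = level_eq(1)[OF eqs npos]
    have "pi * real (Suc (\<kappa> q)) / real n = pi / 2 - pi / (2 * real q) + pi / real n"
      unfolding leq[symmetric] by (simp add: add_divide_distrib distrib_left)
    moreover have "real (2 * e) = real n / real q" using eqs(1) l by (simp add: field_simps)
    ultimately show "T (\<kappa> q) = finite_drop t q n"
      unfolding T_def finite_drop_def level_def using dvd d leq by simp
  qed
  have inj: "inj_on \<kappa> F"
  proof (rule inj_onI)
    fix p q assume "p \<in> F" "q \<in> F" "\<kappa> p = \<kappa> q"
    then show "p = q" using \<kappa>(3)[of p] \<kappa>(3)[of q] assms(4)
      by (metis mult_cancel2 mult_0_right less_numeral_extra(3))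
  qed
  have "(\<Sum>q\<in>F. finite_drop t q n) = sum T (\<kappa> ` F)"
    using \<kappa>(2) by (simp add: sum.reindex[OF inj])
  also have "\<dots> \<le> (\<Sum>k<m. T k)"
  proof (rule sum_mono2)
    show "\<kappa> ` F \<subseteq> {..<m}" using \<kappa>(1) by auto
    show "0 \<le> T k" if "k \<in> {..<m} - \<kappa> ` F" for k
      using that level_antimono[OF assms(1), of k n] by (auto simp: T_def n_def)
  qed simp
  finally show ?thesis
    using rips_eucl_cycle[of n t] assms(4)
    by (simp add: n_def T_def level_def)
qed

text \<open>Up to the factor \<open>- pi / q\<close>, this is a difference quotient of
  \<open>g\<close> at \<open>x\<close> with increment \<open>pi / N j\<close>.\<close>

lemma finite_drop_tendsto:
  assumes "filterlim N at_top sequentially"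
  shows "(\<lambda>j. finite_drop t q (N j)) \<longlonglongrightarrow> 2 * pi * t * limit_term t q"
proof -
  define x where "x = pi / 2 - pi / (2 * real q)"
  define g where "g y = exp (- (2 * sin y * t))" for y
  define D where "D = g x * (- (2 * cos x * t))"
  have "(g has_real_derivative D) (at x)"
    unfolding g_def D_def by (auto intro!: derivative_eq_intros)
  then have lim: "((\<lambda>h. (g (x + h) - g x) / h) \<longlongrightarrow> D) (at 0)" by (simp add: DERIV_def)
  have N: "filterlim (\<lambda>j. real (N j)) at_top sequentially"
    by (rule filterlim_compose[OF filterlim_real_sequentially assms])
  have "filterlim (\<lambda>j. pi / real (N j)) (at 0) sequentially"
  proof (rule filterlim_atI)
    show "(\<lambda>j. pi / real (N j)) \<longlonglongrightarrow> 0"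
      by (rule real_tendsto_divide_at_top[OF tendsto_const N])
    show "\<forall>\<^sub>F j in sequentially. pi / real (N j) \<noteq> 0"
      using filterlim_at_top_dense[THEN iffD1, OF N, rule_format, of 0] by eventually_elim simp
  qed
  from filterlim_compose[OF lim this]
  have "(\<lambda>j. - pi / real q * ((g (x + pi / real (N j)) - g x) / (pi / real (N j))))
      \<longlonglongrightarrow> - pi / real q * D"
    by (intro tendsto_mult_left)
  \<comment> \<open>Division by zero makes both sides \<open>0\<close> when \<open>c\<close> or
    \<open>m\<close> vanishes, so the rewriting applies for every \<open>j\<close> and
    \<open>q\<close>.\<close>
  moreover have "- pi / c * ((a - b) / (pi / m)) = m / c * (b - a)" for a b c m :: real
    by (cases "c = 0"; cases "m = 0") (simp_all add: field_simps)
  ultimately have "(\<lambda>j. finite_drop t q (N j)) \<longlonglongrightarrow> - pi / real q * D"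
    by (simp only: finite_drop_def g_def x_def[symmetric])
  also have "- pi / real q * D = 2 * pi * t * limit_term t q"
    by (simp add: D_def g_def x_def limit_term_def sin_diff cos_diff)
  finally show ?thesis .
qed

section \<open>The supremum as the sum of the series\<close>

theorem theorem9p4:
  fixes t :: real
  assumes "t > 0"
  shows "bdd_above ((\<lambda>n. rips_magnitude (eucl_cycle n) t) ` {n. n \<ge> 1}) \<and>
         (\<lambda>r. 1 / real r * exp (- 2 * t * cos (pi / (2 * real r))) * sin (pi / (2 * real r)))
           summable_on {r::nat. odd r} \<and>
         (SUP n\<in>{n. n \<ge> 1}. rips_magnitude (eucl_cycle n) t) =
           exp (- 2 * t) + 2 * pi * t *
             (\<Sum>\<^sub>\<infinity>r\<in>{r::nat. odd r}.
                1 / real r * exp (- 2 * t * cos (pi / (2 * real r))) * sin (pi / (2 * real r)))"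
proof -
  define S where "S = infsum (limit_term t) {r::nat. odd r}"
  define M where "M = (SUP n\<in>{n. n \<ge> 1}. rips_magnitude (eucl_cycle n) t)"
  have bdd: "bdd_above ((\<lambda>n. rips_magnitude (eucl_cycle n) t) ` {n. n \<ge> 1})"
    by (rule bdd_aboveI2) (rule rips_eucl_cycle_le[OF assms], simp)
  have summable: "limit_term t summable_on {r. odd r}" by (rule limit_term_summable[OF assms])
  have "M \<le> exp (- 2 * t) + 2 * pi * t * S"
    unfolding M_def S_def by (rule cSUP_least) (force, rule rips_eucl_cycle_le[OF assms], simp)
  \<comment> \<open>It suffices to bound each finite partial sum, as a limit of lower bounds along
    suitable cycles.\<close>
  moreover have "S \<le> (M - exp (- 2 * t)) / (2 * pi * t)"
    unfolding S_def
  proof (rule infsum_le_finite_sums[OF summable])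
    fix F :: "nat set" assume F: "finite F" "F \<subseteq> {r. odd r}"
    define P where "P = \<Prod>F"
    have P: "P > 0" unfolding P_def using F(2) by (intro prod_pos) (auto intro: odd_pos)
    \<comment> \<open>Half of \<open>N j\<close> is a positive multiple of every member of
      \<open>F\<close>, and \<open>N j\<close> tends to infinity.\<close>
    define N where "N j = 2 * (P * Suc j)" for j
    have "filterlim N at_top sequentially"
    proof (rule filterlim_at_top_mono[OF filterlim_ident])
      have "1 * j \<le> (2 * P) * Suc j" for j by (rule mult_mono) (use P in auto)
      then show "\<forall>\<^sub>F j in sequentially. j \<le> N j"
        by (intro always_eventually allI) (simp add: N_def mult.assoc)
    qed
    then have "(\<lambda>j. exp (- 2 * t) + (\<Sum>q\<in>F. finite_drop t q (N j)))
        \<longlonglongrightarrow> exp (- 2 * t) + (\<Sum>q\<in>F. 2 * pi * t * limit_term t q)"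
      by (intro tendsto_add tendsto_const tendsto_sum finite_drop_tendsto)
    moreover have "exp (- 2 * t) + (\<Sum>q\<in>F. finite_drop t q (N j)) \<le> M" for j
    proof -
      have "exp (- 2 * t) + (\<Sum>q\<in>F. finite_drop t q (N j)) \<le> rips_magnitude (eucl_cycle (N j)) t"
        unfolding N_def
      proof (rule rips_eucl_cycle_ge[OF assms F(1)])
        show "odd q \<and> q dvd P * Suc j" if "q \<in> F" for q
          using that F dvd_prodI[OF F(1) that, of "\<lambda>x. x"] by (auto simp: P_def)
      qed (use P in simp)
      also have "\<dots> \<le> M" unfolding M_def
        by (rule cSUP_upper[OF _ bdd]) (use P in \<open>simp add: N_def Suc_le_eq\<close>)
      finally show ?thesis .
    qed
    ultimately have "exp (- 2 * t) + (\<Sum>q\<in>F. 2 * pi * t * limit_term t q) \<le> M"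
      by (intro LIMSEQ_le_const2) auto
    then have "2 * pi * t * sum (limit_term t) F \<le> M - exp (- 2 * t)"
      by (simp only: sum_distrib_left[symmetric])
    then show "sum (limit_term t) F \<le> (M - exp (- 2 * t)) / (2 * pi * t)"
      using assms by (simp add: pos_le_divide_eq mult_ac)
  qed
  ultimately have "M = exp (- 2 * t) + 2 * pi * t * S"
    using assms by (simp add: field_simps)
  then show ?thesis using bdd summable by (simp add: M_def S_def limit_term_def[abs_def])
qed

end
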